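(* Let $\mathbf k$ be a commutative unital ring, and let $\Psi$ and $\Gamma$ be the triples (monads) on the category $\Sigma\text{-}\mathtt{mod}$ of $\Sigma$-modules over $\mathbf k$ induced by the free non-unital operad functor and the free operad functor, respectively. A $\Sigma$-module $\mathcal S$ is a $\Psi$-algebra if and only if it is a non-unital operad, and it is a $\Gamma$-algebra if and only if it is an operad. In shorthand, there are isomorphisms of categories $$\mathtt{Alg}_{\Psi}(\Sigma\text{-}\mathtt{mod})\cong\psi\mathtt{Oper}\quad\text{and}\quad \mathtt{Alg}_{\Gamma}(\Sigma\text{-}\mathtt{mod})\cong\mathtt{Oper},$$ where $\psi\mathtt{Oper}$ is the category of non-unital operads and $\mathtt{Oper}$ the category of operads.
   Context: $\Sigma_n$ is the symmetric group on $\{1,\dots,n\}$. A **$\Sigma$-module** is a collection $E=\{E(n)\}_{n\ge0}$ in which each $E(n)$ is a right $\mathbf k[\Sigma_n]$-module; morphisms are sequences of equivariant $\mathbf k$-linear maps. A **non-unital operad** (Markl's) is a $\Sigma$-module $\mathcal S=\{\mathcal S(n)\}_{n\ge0}$ with $\mathbf k$-linear maps $\circ_i:\mathcal S(m)\otimes\mathcal S(n)\to\mathcal S(m+n-1)$ for $1\le i\le m$, $n\ge0$, such that: (Associativity) For $1\le j\le a$, $b,c\ge0$, $f\in\mathcal S(a)$, $g\in\mathcal S(b)$, $h\in\mathcal S(c)$: $(f\circ_jg)\circ_ih=(f\circ_ih)\circ_{j+c-1}g$ if $1\le i<j$; $=f\circ_j(g\circ_{i-j+1}h)$ if $j\le i<b+j$;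 $=(f\circ_{i-b+1}h)\circ_jg$ if $j+b\le i\le a+b-1$. (Equivariance) $(f\tau)\circ_i(g\sigma)=(f\circ_{\tau(i)}g)(\tau\circ_i\sigma)$ for $f\in\mathcal S(m)$, $g\in\mathcal S(n)$, $\tau\in\Sigma_m$, $\sigma\in\Sigma_n$, where $\tau\circ_i\sigma\in\Sigma_{m+n-1}$ is obtained by inserting $\sigma$ at the $i$th place of $\tau$: apply $\sigma$ inside the block $\{i,\dots,i+n-1\}$, then permute the $m$ blocks of lengths $1,\dots,1,n,1,\dots,1$ ($n$ at place $i$) as $\tau$ permutes $1,\dots,m$. An **operad** is a non-unital operad $\mathcal S$ for which there is $e\in\mathcal S(1)$ (the unit) with $f\circ_ie=f$ and $e\circ_1g=g$ for all $f\in\mathcal S(m)$, $1\le i\le m$, $g\in\mathcal S(n)$, $n\ge0$. Morphisms of non-unital operads are equivariant $\mathbf k$-linear maps commuting with all $\circ_i$; morphisms of operads also preserve units. The **free non-unital operad functor** $\Psi:\Sigma\text{-}\mathtt{mod}\to\psi\mathtt{Oper}$ is the left adjoint of the forgetful functor $U_\psi:\psi\mathtt{Oper}\to\Sigma\text{-}\mathtt{mod}$, and the **free operad functor** $\Gamma:\Sigma\text{-}\mathtt{mod}\to\mathtt{Oper}$ is the left adjoint of the forgetful functor $U:\mathtt{Oper}\to\Sigma\text{-}\mathtt{mod}$ (both left adjoints exist). The composites $U_\psi\Psi$ and $U\Gamma$, denoted simply $\Psi$ and $\Gamma$, are triples (monads) on $\Sigma\text{-}\mathtt{mod}$, with unit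 the unit of the adjunction and multiplication induced by the counit. For a triple $(T,\mu,\upsilon)$ on a category $\mathcal C$, a **$T$-algebra** is an object $A$ with a morphism $\alpha:T(A)\to A$ such that $\alpha\circ T(\alpha)=\alpha\circ\mu_A$ and $\alpha\circ\upsilon_A=\mathrm{id}_A$; $\mathtt{Alg}_T(\mathcal C)$ is the category of $T$-algebras, with morphisms those morphisms of $\mathcal C$ that commute with the structure morphisms. *)

theory Defs
  imports "HOL-Algebra.Module" "HOL-Algebra.Sym_Groups"
begin

section \<open>Categories, adjunctions and triples\<close>

text \<open>
  Hom-sets need not be disjoint: the operations on arrows take the objects involved as arguments,
  and \<open>Cmp C a b c g f\<close> is the composite of \<open>f : a \<rightarrow> b\<close> and \<open>g : b \<rightarrow> c\<close>.
\<close>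

record ('o, 'm) category =
  Obj :: "'o set"
  Mor :: "'o \<Rightarrow> 'o \<Rightarrow> 'm set"
  Idt :: "'o \<Rightarrow> 'm"
  Cmp :: "'o \<Rightarrow> 'o \<Rightarrow> 'o \<Rightarrow> 'm \<Rightarrow> 'm \<Rightarrow> 'm"

locale category =
  fixes C :: "('o, 'm) category"
  assumes Idt_in: "a \<in> Obj C \<Longrightarrow> Idt C a \<in> Mor C a a"
    and Cmp_in:
      "\<lbrakk>a \<in> Obj C; b \<in> Obj C; c \<in> Obj C; f \<in> Mor C a b; g \<in> Mor C b c\<rbrakk>
        \<Longrightarrow> Cmp C a b c g f \<in> Mor C a c"
    and Cmp_Idt: "\<lbrakk>a \<in> Obj C; b \<in> Obj C; f \<in> Mor C a b\<rbrakk> \<Longrightarrow> Cmp C a a b f (Idt C a) = f"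
    and Idt_Cmp: "\<lbrakk>a \<in> Obj C; b \<in> Obj C; f \<in> Mor C a b\<rbrakk> \<Longrightarrow> Cmp C a b b (Idt C b) f = f"
    and Cmp_assoc:
      "\<lbrakk>a \<in> Obj C; b \<in> Obj C; c \<in> Obj C; d \<in> Obj C;
        f \<in> Mor C a b; g \<in> Mor C b c; h \<in> Mor C c d\<rbrakk>
        \<Longrightarrow> Cmp C a b d (Cmp C b c d h g) f = Cmp C a c d h (Cmp C a b c g f)"

record ('o1, 'm1, 'o2, 'm2) cfunctor =
  omap :: "'o1 \<Rightarrow> 'o2"
  amap :: "'o1 \<Rightarrow> 'o1 \<Rightarrow> 'm1 \<Rightarrow> 'm2"

locale cat_functor = C: category C + D: category D
  for C :: "('o1, 'm1) category" and D :: "('o2, 'm2) category" +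
  fixes F :: "('o1, 'm1, 'o2, 'm2) cfunctor"
  assumes omap_in: "a \<in> Obj C \<Longrightarrow> omap F a \<in> Obj D"
    and amap_in:
      "\<lbrakk>a \<in> Obj C; b \<in> Obj C; f \<in> Mor C a b\<rbrakk> \<Longrightarrow> amap F a b f \<in> Mor D (omap F a) (omap F b)"
    and amap_Idt: "a \<in> Obj C \<Longrightarrow> amap F a a (Idt C a) = Idt D (omap F a)"
    and amap_Cmp:
      "\<lbrakk>a \<in> Obj C; b \<in> Obj C; c \<in> Obj C; f \<in> Mor C a b; g \<in> Mor C b c\<rbrakk>
        \<Longrightarrow> amap F a c (Cmp C a b c g f)
          = Cmp D (omap F a) (omap F b) (omap F c) (amap F b c g) (amap F a b f)"

definition id_functor :: "('o, 'm, 'o, 'm) cfunctor"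
  where "id_functor = \<lparr>omap = (\<lambda>a. a), amap = (\<lambda>a b f. f)\<rparr>"

definition comp_functor ::
    "('o2, 'm2, 'o3, 'm3) cfunctor \<Rightarrow> ('o1, 'm1, 'o2, 'm2) cfunctor \<Rightarrow> ('o1, 'm1, 'o3, 'm3) cfunctor"
  where "comp_functor G F =
    \<lparr>omap = (\<lambda>a. omap G (omap F a)),
     amap = (\<lambda>a b f. amap G (omap F a) (omap F b) (amap F a b f))\<rparr>"

definition functor_eq ::
    "('o1, 'm1) category \<Rightarrow> ('o1, 'm1, 'o2, 'm2) cfunctor \<Rightarrow> ('o1, 'm1, 'o2, 'm2) cfunctor \<Rightarrow> bool"
  where "functor_eq C F G \<longleftrightarrow>
    (\<forall>a\<in>Obj C. omap F a = omap G a) \<and>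
    (\<forall>a\<in>Obj C. \<forall>b\<in>Obj C. \<forall>f\<in>Mor C a b. amap F a b f = amap G a b f)"

definition category_isomorphism ::
    "('o1, 'm1) category \<Rightarrow> ('o2, 'm2) category \<Rightarrow> ('o1, 'm1, 'o2, 'm2) cfunctor \<Rightarrow> bool"
  where "category_isomorphism C D F \<longleftrightarrow>
    cat_functor C D F \<and>
    (\<exists>G. cat_functor D C G \<and>
      functor_eq C (comp_functor G F) id_functor \<and>
      functor_eq D (comp_functor F G) id_functor)"

locale nat_transformation = F: cat_functor C D F + G: cat_functor C D G
  for C :: "('o1, 'm1) category" and D :: "('o2, 'm2) category" and F G +
  fixes t :: "'o1 \<Rightarrow> 'm2"
  assumes component_in: "a \<in> Obj C \<Longrightarrow> t a \<in> Mor D (omap F a) (omap G a)"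
    and naturality:
      "\<lbrakk>a \<in> Obj C; b \<in> Obj C; f \<in> Mor C a b\<rbrakk>
        \<Longrightarrow> Cmp D (omap F a) (omap F b) (omap G b) (t b) (amap F a b f)
          = Cmp D (omap F a) (omap G a) (omap G b) (amap G a b f) (t a)"

text \<open>\<open>F\<close> is left adjoint to \<open>U\<close>, with unit \<open>\<eta>\<close> and counit \<open>\<epsilon>\<close>.\<close>

locale adjunction =
  F: cat_functor C D F + U: cat_functor D C U +
  unit: nat_transformation C C id_functor "comp_functor U F" \<eta> +
  counit: nat_transformation D D "comp_functor F U" id_functor \<epsilon>
  for C :: "('o1, 'm1) category" and D :: "('o2, 'm2) category" and F U \<eta> \<epsilon> +
  assumes triangle_F:
      "a \<in> Obj C \<Longrightarrow>
        Cmp D (omap F a) (omap F (omap U (omap F a))) (omap F a)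
          (\<epsilon> (omap F a)) (amap F a (omap U (omap F a)) (\<eta> a))
        = Idt D (omap F a)"
    and triangle_U:
      "d \<in> Obj D \<Longrightarrow>
        Cmp C (omap U d) (omap U (omap F (omap U d))) (omap U d)
          (amap U (omap F (omap U d)) d (\<epsilon> d)) (\<eta> (omap U d))
        = Idt C (omap U d)"

record ('o, 'm) triple =
  tfun :: "('o, 'm, 'o, 'm) cfunctor"
  tmult :: "'o \<Rightarrow> 'm"
  tunit :: "'o \<Rightarrow> 'm"

definition induced_triple ::
    "('o1, 'm1, 'o2, 'm2) cfunctor \<Rightarrow> ('o2, 'm2, 'o1, 'm1) cfunctor
      \<Rightarrow> ('o1 \<Rightarrow> 'm1) \<Rightarrow> ('o2 \<Rightarrow> 'm2) \<Rightarrow> ('o1, 'm1) triple"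
  where "induced_triple F U \<eta> \<epsilon> =
    \<lparr>tfun = comp_functor U F,
     tmult = (\<lambda>a. amap U (omap F (omap U (omap F a))) (omap F a) (\<epsilon> (omap F a))),
     tunit = \<eta>\<rparr>"

definition triple_algebra :: "('o, 'm) category \<Rightarrow> ('o, 'm) triple \<Rightarrow> 'o \<Rightarrow> 'm \<Rightarrow> bool"
  where "triple_algebra C T a \<alpha> \<longleftrightarrow>
    (let Ta = omap (tfun T) a; TTa = omap (tfun T) Ta in
      a \<in> Obj C \<and> \<alpha> \<in> Mor C Ta a \<and>
      Cmp C TTa Ta a \<alpha> (amap (tfun T) Ta a \<alpha>) = Cmp C TTa Ta a \<alpha> (tmult T a) \<and>
      Cmp C a Ta a \<alpha> (tunit T a) = Idt C a)"

definition algebra_cat :: "('o, 'm) category \<Rightarrow> ('o, 'm) triple \<Rightarrow> ('o \<times> 'm, 'm) category"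
  where "algebra_cat C T =
    \<lparr>Obj = {(a, \<alpha>). triple_algebra C T a \<alpha>},
     Mor = (\<lambda>(a, \<alpha>) (b, \<beta>). {f \<in> Mor C a b.
       Cmp C (omap (tfun T) a) a b f \<alpha>
       = Cmp C (omap (tfun T) a) (omap (tfun T) b) b \<beta> (amap (tfun T) a b f)}),
     Idt = (\<lambda>(a, \<alpha>). Idt C a),
     Cmp = (\<lambda>(a, \<alpha>) (b, \<beta>) (c, \<gamma>) g f. Cmp C a b c g f)\<rparr>"

definition algebra_forget :: "('o \<times> 'm, 'm, 'o, 'm) cfunctor"
  where "algebra_forget = \<lparr>omap = fst, amap = (\<lambda>A B f. f)\<rparr>"


section \<open>\<open>\<Sigma>\<close>-modules\<close>

text \<open>
  A right \<open>k[\<Sigma>\<^sub>n]\<close>-module is given as a \<open>k\<close>-module with a \<open>k\<close>-linear right action of \<open>\<Sigma>\<^sub>n\<close>.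
  The type \<open>'a\<close> plays the role of a universe: all the carriers are subsets of it, and the
  carriers in different arities may overlap.
\<close>

record ('k, 'a) sigma_module =
  level :: "nat \<Rightarrow> ('k, 'a) module"
  act :: "nat \<Rightarrow> 'a \<Rightarrow> (nat \<Rightarrow> nat) \<Rightarrow> 'a"

locale sigma_module = R?: cring R
  for R :: "('k, 'r) ring_scheme" (structure) +
  fixes S :: "('k, 'a, 's) sigma_module_scheme"
  assumes level_module: "module R (level S n)"
    and act_closed:
      "\<lbrakk>x \<in> carrier (level S n); \<sigma> \<in> carrier (sym_group n)\<rbrakk>
        \<Longrightarrow> act S n x \<sigma> \<in> carrier (level S n)"
    and act_add:
      "\<lbrakk>x \<in> carrier (level S n); y \<in> carrier (level S n); \<sigma> \<in> carrier (sym_group n)\<rbrakk>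
        \<Longrightarrow> act S n (x \<oplus>\<^bsub>level S n\<^esub> y) \<sigma> = act S n x \<sigma> \<oplus>\<^bsub>level S n\<^esub> act S n y \<sigma>"
    and act_smult:
      "\<lbrakk>r \<in> carrier R; x \<in> carrier (level S n); \<sigma> \<in> carrier (sym_group n)\<rbrakk>
        \<Longrightarrow> act S n (r \<odot>\<^bsub>level S n\<^esub> x) \<sigma> = r \<odot>\<^bsub>level S n\<^esub> act S n x \<sigma>"
    and act_one: "x \<in> carrier (level S n) \<Longrightarrow> act S n x \<one>\<^bsub>sym_group n\<^esub> = x"
    and act_mult:
      "\<lbrakk>x \<in> carrier (level S n); \<sigma> \<in> carrier (sym_group n); \<tau> \<in> carrier (sym_group n)\<rbrakk>
        \<Longrightarrow> act S n x (\<sigma> \<otimes>\<^bsub>sym_group n\<^esub> \<tau>) = act S n (act S n x \<sigma>) \<tau>"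

definition sigma_hom ::
    "('k, 'r) ring_scheme \<Rightarrow> ('k, 'a, 's) sigma_module_scheme \<Rightarrow> ('k, 'a, 't) sigma_module_scheme
      \<Rightarrow> (nat \<Rightarrow> 'a \<Rightarrow> 'a) set"
  where "sigma_hom R S T = {\<phi>. \<forall>n.
    \<phi> n \<in> carrier (level S n) \<rightarrow>\<^sub>E carrier (level T n) \<and>
    (\<forall>x\<in>carrier (level S n). \<forall>y\<in>carrier (level S n).
      \<phi> n (x \<oplus>\<^bsub>level S n\<^esub> y) = \<phi> n x \<oplus>\<^bsub>level T n\<^esub> \<phi> n y) \<and>
    (\<forall>r\<in>carrier R. \<forall>x\<in>carrier (level S n).
      \<phi> n (r \<odot>\<^bsub>level S n\<^esub> x) = r \<odot>\<^bsub>level T n\<^esub> \<phi> n x) \<and>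
    (\<forall>x\<in>carrier (level S n). \<forall>\<sigma>\<in>carrier (sym_group n).
      \<phi> n (act S n x \<sigma>) = act T n (\<phi> n x) \<sigma>)}"

definition sigma_idt :: "('k, 'a, 's) sigma_module_scheme \<Rightarrow> nat \<Rightarrow> 'a \<Rightarrow> 'a"
  where "sigma_idt S = (\<lambda>n. \<lambda>x\<in>carrier (level S n). x)"

definition sigma_cmp ::
    "('k, 'a, 's) sigma_module_scheme \<Rightarrow> (nat \<Rightarrow> 'a \<Rightarrow> 'a) \<Rightarrow> (nat \<Rightarrow> 'a \<Rightarrow> 'a) \<Rightarrow> nat \<Rightarrow> 'a \<Rightarrow> 'a"
  where "sigma_cmp S \<psi> \<phi> = (\<lambda>n. compose (carrier (level S n)) (\<psi> n) (\<phi> n))"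

definition sigma_cat ::
    "('k, 'r) ring_scheme \<Rightarrow> (('k, 'a) sigma_module, nat \<Rightarrow> 'a \<Rightarrow> 'a) category"
  where "sigma_cat R =
    \<lparr>Obj = {S. sigma_module R S},
     Mor = sigma_hom R,
     Idt = sigma_idt,
     Cmp = (\<lambda>S T V. sigma_cmp S)\<rparr>"


section \<open>Non-unital operads and operads\<close>

text \<open>
  The permutation \<open>\<tau> \<circ>\<^sub>i \<sigma>\<close> of \<open>{1..m+n-1}\<close>. The \<open>i\<close>-th of the \<open>m\<close> blocks is \<open>{i..<i+n}\<close> and is moved
  to \<open>{\<tau> i..<\<tau> i+n}\<close>; a point \<open>p\<close> outside it is the block number \<open>p\<close> if \<open>p < i\<close> and \<open>p+1-n\<close> otherwise.
\<close>

definition insert_perm ::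
    "nat \<Rightarrow> nat \<Rightarrow> nat \<Rightarrow> (nat \<Rightarrow> nat) \<Rightarrow> (nat \<Rightarrow> nat) \<Rightarrow> nat \<Rightarrow> nat"
  where "insert_perm m n i \<tau> \<sigma> p =
    (if p \<notin> {1..m+n-1} then p
     else if p \<in> {i..<i+n} then \<tau> i + \<sigma> (p - i + 1) - 1
     else let b = (if p < i then p else p + 1 - n)
          in if \<tau> b < \<tau> i then \<tau> b else \<tau> b + n - 1)"

text \<open>\<open>circ P m n i f g\<close> is \<open>f \<circ>\<^sub>i g\<close> for \<open>f\<close> of arity \<open>m\<close> and \<open>g\<close> of arity \<open>n\<close>.\<close>

record ('k, 'a) operad = "('k, 'a) sigma_module" +
  circ :: "nat \<Rightarrow> nat \<Rightarrow> nat \<Rightarrow> 'a \<Rightarrow> 'a \<Rightarrow> 'a"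

text \<open>
  The \<open>k\<close>-linear maps out of \<open>S(m) \<otimes> S(n)\<close> are given as \<open>k\<close>-bilinear maps. By \<open>circ_undefined\<close>
  they are determined by their values on the carriers, so that equality of operads as records
  is equality of their underlying \<open>\<Sigma>\<close>-modules and of their partial compositions.
\<close>

locale nonunital_operad = sigma_module R P
  for R :: "('k, 'r) ring_scheme" (structure) and P :: "('k, 'a) operad" +
  assumes circ_undefined:
      "\<not> (1 \<le> i \<and> i \<le> m \<and> f \<in> carrier (level P m) \<and> g \<in> carrier (level P n))
        \<Longrightarrow> circ P m n i f g = undefined"
    and circ_closed:
      "\<lbrakk>1 \<le> i; i \<le> m; f \<in> carrier (level P m); g \<in> carrier (level P n)\<rbrakk>
        \<Longrightarrow> circ P m n i f g \<in> carrier (level P (m + n - 1))"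
    and circ_add_left:
      "\<lbrakk>1 \<le> i; i \<le> m; f \<in> carrier (level P m); f' \<in> carrier (level P m); g \<in> carrier (level P n)\<rbrakk>
        \<Longrightarrow> circ P m n i (f \<oplus>\<^bsub>level P m\<^esub> f') g
          = circ P m n i f g \<oplus>\<^bsub>level P (m + n - 1)\<^esub> circ P m n i f' g"
    and circ_add_right:
      "\<lbrakk>1 \<le> i; i \<le> m; f \<in> carrier (level P m); g \<in> carrier (level P n); g' \<in> carrier (level P n)\<rbrakk>
        \<Longrightarrow> circ P m n i f (g \<oplus>\<^bsub>level P n\<^esub> g')
          = circ P m n i f g \<oplus>\<^bsub>level P (m + n - 1)\<^esub> circ P m n i f g'"
    and circ_smult_left:
      "\<lbrakk>1 \<le> i; i \<le> m; r \<in> carrier R; f \<in> carrier (level P m); g \<in> carrier (level P n)\<rbrakk>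
        \<Longrightarrow> circ P m n i (r \<odot>\<^bsub>level P m\<^esub> f) g = r \<odot>\<^bsub>level P (m + n - 1)\<^esub> circ P m n i f g"
    and circ_smult_right:
      "\<lbrakk>1 \<le> i; i \<le> m; r \<in> carrier R; f \<in> carrier (level P m); g \<in> carrier (level P n)\<rbrakk>
        \<Longrightarrow> circ P m n i f (r \<odot>\<^bsub>level P n\<^esub> g) = r \<odot>\<^bsub>level P (m + n - 1)\<^esub> circ P m n i f g"
    and circ_assoc_left:
      "\<lbrakk>1 \<le> j; j \<le> a; f \<in> carrier (level P a); g \<in> carrier (level P b); h \<in> carrier (level P c);
        1 \<le> i; i < j\<rbrakk>
        \<Longrightarrow> circ P (a + b - 1) c i (circ P a b j f g) h
          = circ P (a + c - 1) b (j + c - 1) (circ P a c i f h) g"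
    and circ_assoc_middle:
      "\<lbrakk>1 \<le> j; j \<le> a; f \<in> carrier (level P a); g \<in> carrier (level P b); h \<in> carrier (level P c);
        j \<le> i; i < b + j\<rbrakk>
        \<Longrightarrow> circ P (a + b - 1) c i (circ P a b j f g) h
          = circ P a (b + c - 1) j f (circ P b c (i - j + 1) g h)"
    and circ_assoc_right:
      "\<lbrakk>1 \<le> j; j \<le> a; f \<in> carrier (level P a); g \<in> carrier (level P b); h \<in> carrier (level P c);
        j + b \<le> i; i \<le> a + b - 1\<rbrakk>
        \<Longrightarrow> circ P (a + b - 1) c i (circ P a b j f g) h
          = circ P (a + c - 1) b j (circ P a c (i - b + 1) f h) g"
    and circ_equivariant:
      "\<lbrakk>1 \<le> i; i \<le> m; f \<in> carrier (level P m); g \<in> carrier (level P n);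
        \<tau> \<in> carrier (sym_group m); \<sigma> \<in> carrier (sym_group n)\<rbrakk>
        \<Longrightarrow> circ P m n i (act P m f \<tau>) (act P n g \<sigma>)
          = act P (m + n - 1) (circ P m n (\<tau> i) f g) (insert_perm m n i \<tau> \<sigma>)"

definition operad_unit :: "('k, 'a) operad \<Rightarrow> 'a \<Rightarrow> bool"
  where "operad_unit P e \<longleftrightarrow>
    e \<in> carrier (level P 1) \<and>
    (\<forall>m. \<forall>f\<in>carrier (level P m). \<forall>i\<in>{1..m}. circ P m 1 i f e = f) \<and>
    (\<forall>n. \<forall>g\<in>carrier (level P n). circ P 1 n 1 e g = g)"

locale operad = nonunital_operad +
  assumes unit_exists: "\<exists>e. operad_unit P e"

definition nonunital_operad_hom ::
    "('k, 'r) ring_scheme \<Rightarrow> ('k, 'a) operad \<Rightarrow> ('k, 'a) operad \<Rightarrow> (nat \<Rightarrow> 'a \<Rightarrow> 'a) set"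
  where "nonunital_operad_hom R P Q = {\<phi> \<in> sigma_hom R P Q.
    \<forall>m n. \<forall>i\<in>{1..m}. \<forall>f\<in>carrier (level P m). \<forall>g\<in>carrier (level P n).
      \<phi> (m + n - 1) (circ P m n i f g) = circ Q m n i (\<phi> m f) (\<phi> n g)}"

definition operad_hom ::
    "('k, 'r) ring_scheme \<Rightarrow> ('k, 'a) operad \<Rightarrow> ('k, 'a) operad \<Rightarrow> (nat \<Rightarrow> 'a \<Rightarrow> 'a) set"
  where "operad_hom R P Q = {\<phi> \<in> nonunital_operad_hom R P Q.
    \<forall>e. operad_unit P e \<longrightarrow> operad_unit Q (\<phi> 1 e)}"

definition nonunital_operad_cat ::
    "('k, 'r) ring_scheme \<Rightarrow> (('k, 'a) operad, nat \<Rightarrow> 'a \<Rightarrow> 'a) category"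
  where "nonunital_operad_cat R =
    \<lparr>Obj = {P. nonunital_operad R P},
     Mor = nonunital_operad_hom R,
     Idt = sigma_idt,
     Cmp = (\<lambda>P Q V. sigma_cmp P)\<rparr>"

definition operad_cat ::
    "('k, 'r) ring_scheme \<Rightarrow> (('k, 'a) operad, nat \<Rightarrow> 'a \<Rightarrow> 'a) category"
  where "operad_cat R =
    \<lparr>Obj = {P. operad R P},
     Mor = operad_hom R,
     Idt = sigma_idt,
     Cmp = (\<lambda>P Q V. sigma_cmp P)\<rparr>"

definition operad_forget ::
    "(('k, 'a) operad, nat \<Rightarrow> 'a \<Rightarrow> 'a, ('k, 'a) sigma_module, nat \<Rightarrow> 'a \<Rightarrow> 'a) cfunctor"
  where "operad_forget = \<lparr>omap = sigma_module.truncate, amap = (\<lambda>P Q \<phi>. \<phi>)\<rparr>"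

end

theory Submission
  imports Defs
begin

text \<open>
  For an algebra \<open>\<alpha> : T S \<rightarrow> S\<close> put \<open>f \<circ>\<^sub>i g = \<alpha> (\<eta> f \<circ>\<^sub>i \<eta> g)\<close>, the right-hand composition being that of
  the free operad \<open>F S\<close>. The associativity law of \<open>\<alpha>\<close> makes \<open>\<alpha>\<close> compatible with the compositions,
  and \<open>\<alpha> \<circ> \<eta> = id\<close> makes it surjective; so \<open>S\<close> is a quotient of \<open>F S\<close> and inherits the operad
  axioms and, in the unital case, the unit. Conversely an operad \<open>P\<close> is an algebra through the
  counit \<open>\<epsilon>\<^sub>P\<close>, and morphisms out of \<open>F S\<close> that agree on the image of \<open>\<eta>\<close> are equal, which makes the
  two constructions mutually inverse and identifies the morphisms. No description of the free
  operad is needed, only its universal property.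
\<close>

section \<open>Algebras over the triple of an adjunction, and a criterion for strict
  monadicity\<close>

text \<open>An arrow out of \<open>F a\<close> is recovered from its transpose \<open>U h\<close>
  after \<open>\<eta> a\<close>: apply \<open>F\<close> and compose with
  \<open>\<epsilon> d\<close>. This is the uniqueness half of the universal property of the free
  object.\<close>

lemma (in adjunction) hom_eq_if_unit_eq:
  assumes a: "a \<in> Obj C" and d: "d \<in> Obj D"
    and h: "h \<in> Mor D (omap F a) d" and h': "h' \<in> Mor D (omap F a) d"
    and eq: "Cmp C a (omap U (omap F a)) (omap U d) (amap U (omap F a) d h) (\<eta> a)
      = Cmp C a (omap U (omap F a)) (omap U d) (amap U (omap F a) d h') (\<eta> a)"
  shows "h = h'"
proof -
  have fa: "omap F a \<in> Obj D" and ufa: "omap U (omap F a) \<in> Obj C"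
    and fufa: "omap F (omap U (omap F a)) \<in> Obj D"
    and ud: "omap U d \<in> Obj C" and fud: "omap F (omap U d) \<in> Obj D"
    using a d by (auto intro: F.omap_in U.omap_in)
  have eta: "\<eta> a \<in> Mor C a (omap U (omap F a))"
    using unit.component_in[OF a] by (simp add: id_functor_def comp_functor_def)
  have eps: "\<epsilon> d \<in> Mor D (omap F (omap U d)) d"
    and epsF: "\<epsilon> (omap F a) \<in> Mor D (omap F (omap U (omap F a))) (omap F a)"
    using counit.component_in[OF d] counit.component_in[OF fa]
    by (simp_all add: id_functor_def comp_functor_def)
  have key: "g = Cmp D (omap F a) (omap F (omap U d)) d (\<epsilon> d)
      (amap F a (omap U d)
        (Cmp C a (omap U (omap F a)) (omap U d) (amap U (omap F a) d g) (\<eta> a)))"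
    if g: "g \<in> Mor D (omap F a) d" for g
  proof -
    let ?FUg = "amap F (omap U (omap F a)) (omap U d) (amap U (omap F a) d g)"
    let ?Feta = "amap F a (omap U (omap F a)) (\<eta> a)"
    have ug: "amap U (omap F a) d g \<in> Mor C (omap U (omap F a)) (omap U d)"
      by (rule U.amap_in[OF fa d g])
    have fug: "?FUg \<in> Mor D (omap F (omap U (omap F a))) (omap F (omap U d))"
      by (rule F.amap_in[OF ufa ud ug])
    have feta: "?Feta \<in> Mor D (omap F a) (omap F (omap U (omap F a)))"
      by (rule F.amap_in[OF a ufa eta])
    have "g = Cmp D (omap F a) (omap F a) d g
        (Cmp D (omap F a) (omap F (omap U (omap F a))) (omap F a) (\<epsilon> (omap F a)) ?Feta)"
      using F.D.Cmp_Idt[OF fa d g] triangle_F[OF a] by simp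
    also have "\<dots> = Cmp D (omap F a) (omap F (omap U (omap F a))) d
        (Cmp D (omap F (omap U (omap F a))) (omap F a) d g (\<epsilon> (omap F a))) ?Feta"
      using F.D.Cmp_assoc[OF fa fufa fa d feta epsF g] by simp
    \<comment> \<open>Naturality of the counit at \<open>g\<close> moves \<open>g\<close> inside
      \<open>F U\<close>, where it can be merged with \<open>F (\<eta> a)\<close> by
      functoriality.\<close>
    also have "Cmp D (omap F (omap U (omap F a))) (omap F a) d g (\<epsilon> (omap F a))
        = Cmp D (omap F (omap U (omap F a))) (omap F (omap U d)) d (\<epsilon> d) ?FUg"
      using counit.naturality[OF fa d g] by (simp add: id_functor_def comp_functor_def)
    also have "Cmp D (omap F a) (omap F (omap U (omap F a))) d \<dots> ?Feta
        = Cmp D (omap F a) (omap F (omap U d)) d (\<epsilon> d)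
          (Cmp D (omap F a) (omap F (omap U (omap F a))) (omap F (omap U d)) ?FUg ?Feta)"
      by (rule F.D.Cmp_assoc[OF fa fufa fud d feta fug eps])
    finally show ?thesis using F.amap_Cmp[OF a ufa ud eta ug] by simp
  qed
  show ?thesis using key[OF h] key[OF h'] eq by simp
qed

text \<open>The unit law is the triangle identity for \<open>U\<close>. The associativity law is
  naturality of the counit at the arrow \<open>\<epsilon> d\<close> itself, pushed through
  \<open>U\<close>.\<close>

lemma (in adjunction) counit_triple_algebra:
  assumes d: "d \<in> Obj D"
  shows "triple_algebra C (induced_triple F U \<eta> \<epsilon>) (omap U d)
    (amap U (omap F (omap U d)) d (\<epsilon> d))"
proof -
  have ud: "omap U d \<in> Obj C" and fud: "omap F (omap U d) \<in> Obj D"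
    and ufud: "omap U (omap F (omap U d)) \<in> Obj C"
    and fufud: "omap F (omap U (omap F (omap U d))) \<in> Obj D"
    using d by (auto intro: F.omap_in U.omap_in)
  have eps: "\<epsilon> d \<in> Mor D (omap F (omap U d)) d"
    and epsF: "\<epsilon> (omap F (omap U d)) \<in> Mor D (omap F (omap U (omap F (omap U d)))) (omap F (omap U d))"
    using counit.component_in[OF d] counit.component_in[OF fud]
    by (simp_all add: id_functor_def comp_functor_def)
  have ueps: "amap U (omap F (omap U d)) d (\<epsilon> d) \<in> Mor C (omap U (omap F (omap U d))) (omap U d)"
    by (rule U.amap_in[OF fud d eps])
  note fueps = F.amap_in[OF ufud ud ueps]
  show ?thesis
    using ud ueps triangle_U[OF d] counit.naturality[OF fud d eps]
      U.amap_Cmp[OF fufud fud d fueps eps] U.amap_Cmp[OF fufud fud d epsF eps]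
    by (simp add: triple_algebra_def induced_triple_def id_functor_def comp_functor_def Let_def)
qed

text \<open>Pasting the commuting squares of two algebra morphisms gives the square of their
  composite; the remaining laws are inherited from \<open>C\<close>.\<close>

lemma category_algebra_cat:
  assumes "cat_functor C C (tfun T)"
  shows "category (algebra_cat C T)"
proof -
  define F where "F = tfun T"
  interpret cat_functor C C F using assms by (simp add: F_def)
  have F: "tfun T = F" by (simp add: F_def)
  have Obj: "a \<in> Obj C" "\<alpha> \<in> Mor C (omap F a) a" "omap F a \<in> Obj C"
    if "triple_algebra C T a \<alpha>" for a \<alpha>
    using that F omap_in by (auto simp: triple_algebra_def Let_def)
  show ?thesis
  proof (unfold_locales, goal_cases)
    case (1 A)
    then show ?case
      using Obj C.Idt_in C.Idt_Cmp C.Cmp_Idt amap_Idt F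
      by (auto simp: algebra_cat_def)
  next
    case (2 A B E f g)
    obtain a \<alpha> b \<beta> c \<gamma> where A: "A = (a, \<alpha>)" "B = (b, \<beta>)" "E = (c, \<gamma>)"
      by (metis surj_pair)
    have al: "triple_algebra C T a \<alpha>" "triple_algebra C T b \<beta>" "triple_algebra C T c \<gamma>"
      and f: "f \<in> Mor C a b" "Cmp C (omap F a) a b f \<alpha> = Cmp C (omap F a) (omap F b) b \<beta> (amap F a b f)"
      and g: "g \<in> Mor C b c" "Cmp C (omap F b) b c g \<beta> = Cmp C (omap F b) (omap F c) c \<gamma> (amap F b c g)"
      using 2 F by (auto simp: A algebra_cat_def)
    note o = Obj[OF al(1)] Obj[OF al(2)] Obj[OF al(3)]
    have Ff: "amap F a b f \<in> Mor C (omap F a) (omap F b)"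
      and Fg: "amap F b c g \<in> Mor C (omap F b) (omap F c)"
      using amap_in o f g F by auto
    have "Cmp C (omap F a) a c (Cmp C a b c g f) \<alpha> = Cmp C (omap F a) b c g (Cmp C (omap F a) a b f \<alpha>)"
      using C.Cmp_assoc o f g by metis
    also have "\<dots> = Cmp C (omap F a) (omap F b) c (Cmp C (omap F b) b c g \<beta>) (amap F a b f)"
      using C.Cmp_assoc[of "omap F a" "omap F b" b c "amap F a b f" \<beta> g] o f g Ff by metis
    also have "\<dots> = Cmp C (omap F a) (omap F c) c \<gamma>
        (Cmp C (omap F a) (omap F b) (omap F c) (amap F b c g) (amap F a b f))"
      using C.Cmp_assoc[of "omap F a" "omap F b" "omap F c" c "amap F a b f" "amap F b c g" \<gamma>]
        o f g Ff Fg by metis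
    also have "\<dots> = Cmp C (omap F a) (omap F c) c \<gamma> (amap F a c (Cmp C a b c g f))"
      using amap_Cmp[of a b c f g] o f g F by simp
    finally show ?case
      using C.Cmp_in o f g F by (auto simp: A algebra_cat_def)
  next
    case (3 A B f)
    then show ?case using Obj C.Cmp_Idt by (auto simp: algebra_cat_def)
  next
    case (4 A B f)
    then show ?case using Obj C.Idt_Cmp by (auto simp: algebra_cat_def)
  next
    case (5 A B E G f g h)
    then show ?case using Obj C.Cmp_assoc by (auto simp: algebra_cat_def)
  qed
qed

text \<open>The comparison functor sends \<open>d\<close> to \<open>U d\<close> with structure map
  \<open>\<epsilon> d\<close>. It is surjective on objects by \<open>lift_algebra\<close>, injective
  by \<open>counit_inj\<close>, and full by \<open>lift_hom\<close>. As \<open>U\<close> is the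
  identity on arrows, all isomorphisms here are strict, and \<open>K\<close> is the inverse of the
  comparison functor.\<close>

lemma category_isomorphism_algebra_cat:
  fixes C :: "('o1, 'm) category" and D :: "('o2, 'm) category"
  assumes adj: "adjunction C D F U \<eta> \<epsilon>"
    and amap_U: "\<And>a b f. amap U a b f = f"
    and lift_algebra: "\<And>a \<alpha>. triple_algebra C (induced_triple F U \<eta> \<epsilon>) a \<alpha>
      \<Longrightarrow> \<exists>d\<in>Obj D. omap U d = a \<and> \<epsilon> d = \<alpha>"
    and counit_inj: "\<And>d d'. \<lbrakk>d \<in> Obj D; d' \<in> Obj D; omap U d = omap U d'; \<epsilon> d = \<epsilon> d'\<rbrakk> \<Longrightarrow> d = d'"
    and lift_hom: "\<And>d d' f. \<lbrakk>d \<in> Obj D; d' \<in> Obj D; f \<in> Mor C (omap U d) (omap U d');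
      Cmp C (omap U (omap F (omap U d))) (omap U d) (omap U d') f (\<epsilon> d)
      = Cmp C (omap U (omap F (omap U d))) (omap U (omap F (omap U d'))) (omap U d') (\<epsilon> d')
          (amap F (omap U d) (omap U d') f)\<rbrakk> \<Longrightarrow> f \<in> Mor D d d'"
  shows "\<exists>K. category_isomorphism (algebra_cat C (induced_triple F U \<eta> \<epsilon>)) D K \<and>
    functor_eq (algebra_cat C (induced_triple F U \<eta> \<epsilon>)) (comp_functor U K) algebra_forget"
proof -
  interpret adjunction C D F U \<eta> \<epsilon> by (rule adj)
  let ?T = "induced_triple F U \<eta> \<epsilon>"
  let ?A = "algebra_cat C ?T"
  have "category ?A"
    by (rule category_algebra_cat) (simp add: induced_triple_def unit.G.cat_functor_axioms)
  then interpret A: category ?A .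
  \<comment> \<open>The object part of the inverse: on algebras the description has a witness by
    \<open>lift_algebra\<close>, which \<open>counit_inj\<close> makes unique.\<close>
  define L where "L A = (THE d. d \<in> Obj D \<and> omap U d = fst A \<and> \<epsilon> d = snd A)"
    for A :: "'o1 \<times> 'm"
  define K where "K = \<lparr>omap = L, amap = (\<lambda>A B f :: 'm. f)\<rparr>"
  define G where "G = \<lparr>omap = (\<lambda>d. (omap U d, \<epsilon> d)), amap = (\<lambda>A B f :: 'm. f)\<rparr>"
  have L_eq: "L (omap U d, \<epsilon> d) = d" if "d \<in> Obj D" for d
    unfolding L_def using that counit_inj by (intro the_equality) auto
  have L_ex: "\<exists>d\<in>Obj D. A = (omap U d, \<epsilon> d)" if "A \<in> Obj ?A" for A
    using that lift_algebra by (fastforce simp: algebra_cat_def)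
  have L: "L A \<in> Obj D \<and> A = (omap U (L A), \<epsilon> (L A))" if A: "A \<in> Obj ?A" for A
  proof -
    obtain d where "d \<in> Obj D" "A = (omap U d, \<epsilon> d)"
      using L_ex[OF A] by blast
    then show ?thesis using L_eq by simp
  qed
  have G_obj: "(omap U d, \<epsilon> d) \<in> Obj ?A" if "d \<in> Obj D" for d
    using counit_triple_algebra[OF that] by (simp add: algebra_cat_def amap_U)
  have Mor_eq: "Mor ?A (omap U d, \<epsilon> d) (omap U d', \<epsilon> d') = Mor D d d'"
    if "d \<in> Obj D" "d' \<in> Obj D" for d d'
  proof
    show "Mor ?A (omap U d, \<epsilon> d) (omap U d', \<epsilon> d') \<subseteq> Mor D d d'"
      using lift_hom[OF that]
      by (auto simp: algebra_cat_def induced_triple_def comp_functor_def amap_U)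
    \<comment> \<open>With \<open>U\<close> the identity on arrows, the algebra morphism equation
      for \<open>f\<close> is naturality of the counit at \<open>f\<close>.\<close>
    show "Mor D d d' \<subseteq> Mor ?A (omap U d, \<epsilon> d) (omap U d', \<epsilon> d')"
    proof
      fix f assume f: "f \<in> Mor D d d'"
      have fC: "f \<in> Mor C (omap U d) (omap U d')"
        using U.amap_in[OF that f] by (simp add: amap_U)
      have obj: "omap U d \<in> Obj C" "omap U d' \<in> Obj C"
        "omap F (omap U d) \<in> Obj D" "omap F (omap U d') \<in> Obj D"
        using that by (auto intro: F.omap_in U.omap_in)
      have eps: "\<epsilon> d \<in> Mor D (omap F (omap U d)) d" "\<epsilon> d' \<in> Mor D (omap F (omap U d')) d'"
        using counit.component_in that by (simp_all add: id_functor_def comp_functor_def)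
      note Ff = F.amap_in[OF obj(1,2) fC]
      show "f \<in> Mor ?A (omap U d, \<epsilon> d) (omap U d', \<epsilon> d')"
        using counit.naturality[OF that f] fC
          U.amap_Cmp[OF obj(3) that eps(1) f] U.amap_Cmp[OF obj(3,4) that(2) Ff eps(2)]
        by (simp add: algebra_cat_def induced_triple_def comp_functor_def id_functor_def amap_U)
    qed
  qed
  have Cmp_eq: "Cmp ?A (omap U d, \<epsilon> d) (omap U d', \<epsilon> d') (omap U d'', \<epsilon> d'') g f
      = Cmp D d d' d'' g f"
    if "d \<in> Obj D" "d' \<in> Obj D" "d'' \<in> Obj D" "f \<in> Mor D d d'" "g \<in> Mor D d' d''" for d d' d'' f g
    using U.amap_Cmp[OF that] by (simp add: algebra_cat_def amap_U)
  have Idt_eq: "Idt ?A (omap U d, \<epsilon> d) = Idt D d" if "d \<in> Obj D" for d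
    using U.amap_Idt[OF that] by (simp add: algebra_cat_def amap_U)
  have K: "cat_functor ?A D K"
  proof (unfold_locales, goal_cases)
    case (1 A) then show ?case using L by (simp add: K_def)
  next
    case (2 A B f)
    then show ?case using L[of A] L[of B] Mor_eq[of "L A" "L B"] by (simp add: K_def)
  next
    case (3 A) then show ?case using L[of A] Idt_eq[of "L A"] by (simp add: K_def)
  next
    case (4 A B E f g)
    then show ?case
      using L[of A] L[of B] L[of E] Mor_eq[of "L A" "L B"] Mor_eq[of "L B" "L E"]
        Cmp_eq[of "L A" "L B" "L E" f g] by (simp add: K_def)
  qed
  have G: "cat_functor D ?A G"
    by unfold_locales (simp_all add: G_def G_obj Mor_eq Idt_eq Cmp_eq)
  have "functor_eq ?A (comp_functor G K) id_functor" "functor_eq D (comp_functor K G) id_functor"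
    "functor_eq ?A (comp_functor U K) algebra_forget"
    using L L_eq
    by (auto simp: functor_eq_def comp_functor_def id_functor_def algebra_forget_def
        G_def K_def amap_U)
  with K G show ?thesis unfolding category_isomorphism_def by blast
qed

section \<open>Inserting one permutation into another\<close>

text \<open>The \<open>i\<close>-th block goes into the interval of length \<open>n\<close> starting
  at \<open>\<tau> i\<close>, and all other points avoid that interval. So injectivity can be
  checked inside and outside the block separately, and an injective self-map of a finite set is
  bijective.\<close>

lemma insert_perm_in_sym_group:
  assumes i: "1 \<le> i" "i \<le> m"
    and \<tau>: "\<tau> \<in> carrier (sym_group m)" and \<sigma>: "\<sigma> \<in> carrier (sym_group n)"
  shows "insert_perm m n i \<tau> \<sigma> \<in> carrier (sym_group (m + n - 1))"
proof -
  let ?I = "{1..m+n-1}" and ?\<rho> = "insert_perm m n i \<tau> \<sigma>"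
  have \<tau>p: "\<tau> permutes {1..m}" and \<sigma>p: "\<sigma> permutes {1..n}"
    using \<tau> \<sigma> by (simp_all add: sym_group_def)
  have \<tau>in: "1 \<le> \<tau> b \<and> \<tau> b \<le> m" if "1 \<le> b" "b \<le> m" for b
    using permutes_in_image[OF \<tau>p, of b] that by simp
  have \<sigma>in: "1 \<le> \<sigma> b \<and> \<sigma> b \<le> n" if "1 \<le> b" "b \<le> n" for b
    using permutes_in_image[OF \<sigma>p, of b] that by simp
  have \<tau>inj: "\<tau> b = \<tau> c \<longleftrightarrow> b = c" and \<sigma>inj: "\<sigma> b = \<sigma> c \<longleftrightarrow> b = c" for b c
    using permutes_inj[OF \<tau>p] permutes_inj[OF \<sigma>p] by (auto simp: inj_eq)
  \<comment> \<open>The number of the block of a point outside the \<open>i\<close>-th block. Points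
    after that block have \<open>p \<ge> i + n\<close>, so their number is at least
    \<open>i + 1\<close>, also when \<open>n = 0\<close> and the block is empty.\<close>
  define blk where "blk p = (if p < i then p else p + 1 - n)" for p
  have blk: "1 \<le> blk p" "blk p \<le> m" "blk p \<noteq> i" if "p \<in> ?I" "p \<notin> {i..<i+n}" for p
    using that i by (auto simp: blk_def split: if_splits)
  have inside: "?\<rho> p = \<tau> i + \<sigma> (p - i + 1) - 1" if "p \<in> ?I" "p \<in> {i..<i+n}" for p
    using that by (simp add: insert_perm_def)
  have outside: "?\<rho> p = (if \<tau> (blk p) < \<tau> i then \<tau> (blk p) else \<tau> (blk p) + n - 1)"
    if "p \<in> ?I" "p \<notin> {i..<i+n}" for p
    using that by (auto simp: insert_perm_def blk_def Let_def)
  have rng_in: "\<tau> i \<le> ?\<rho> p \<and> ?\<rho> p < \<tau> i + n" if "p \<in> ?I" "p \<in> {i..<i+n}" for p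
  proof -
    have "p - i + 1 \<le> n" using that by auto
    then show ?thesis using inside[OF that] \<sigma>in[of "p - i + 1"] \<tau>in[OF i] by auto
  qed
  \<comment> \<open>Since \<open>\<tau> (blk p)\<close> differs from \<open>\<tau> i\<close>, it is
    either kept below \<open>\<tau> i\<close> or shifted by \<open>n - 1\<close> to at least
    \<open>\<tau> i + n\<close>.\<close>
  have rng_out: "?\<rho> p < \<tau> i \<or> \<tau> i + n \<le> ?\<rho> p" if "p \<in> ?I" "p \<notin> {i..<i+n}" for p
    using outside[OF that] \<tau>inj[of "blk p" i] blk[OF that] by auto
  have into: "?\<rho> p \<in> ?I" if "p \<in> ?I" for p
  proof (cases "p \<in> {i..<i+n}")
    case True
    then show ?thesis using rng_in[OF that True] \<tau>in[OF i] by auto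
  next
    case False
    then show ?thesis
      using outside[OF that False] \<tau>in[OF blk(1,2)[OF that False]] \<tau>in[OF i]
        \<tau>inj[of "blk p" i] blk(3)[OF that False] by auto
  qed
  have "inj_on ?\<rho> ?I"
  proof (rule inj_onI)
    fix p q assume p: "p \<in> ?I" and q: "q \<in> ?I" and eq: "?\<rho> p = ?\<rho> q"
    show "p = q"
    proof (cases "p \<in> {i..<i+n}"; cases "q \<in> {i..<i+n}")
      assume *: "p \<in> {i..<i+n}" "q \<in> {i..<i+n}"
      then have "p - i + 1 \<le> n" "q - i + 1 \<le> n" by auto
      then have "\<sigma> (p - i + 1) = \<sigma> (q - i + 1)"
        using eq inside[OF p *(1)] inside[OF q *(2)] \<tau>in[OF i]
          \<sigma>in[of "p - i + 1"] \<sigma>in[of "q - i + 1"] by linarith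
      then show ?thesis using \<sigma>inj * by auto
    next
      assume *: "p \<in> {i..<i+n}" "q \<notin> {i..<i+n}"
      then show ?thesis using rng_in[OF p *(1)] rng_out[OF q *(2)] eq by auto
    next
      assume *: "p \<notin> {i..<i+n}" "q \<in> {i..<i+n}"
      then show ?thesis using rng_out[OF p *(1)] rng_in[OF q *(2)] eq by auto
    next
      assume *: "p \<notin> {i..<i+n}" "q \<notin> {i..<i+n}"
      have "\<tau> (blk p) = \<tau> (blk q)"
        using eq outside[OF p *(1)] outside[OF q *(2)] blk[OF p *(1)] blk[OF q *(2)]
          \<tau>inj[of "blk p" i] \<tau>inj[of "blk q" i] \<tau>in[OF blk(1,2)[OF p *(1)]]
          \<tau>in[OF blk(1,2)[OF q *(2)]]
        by (auto split: if_splits)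
      then show ?thesis using \<tau>inj * by (auto simp: blk_def split: if_splits)
    qed
  qed
  moreover have "?\<rho> ` ?I \<subseteq> ?I" using into by blast
  ultimately have "bij_betw ?\<rho> ?I ?I"
    by (simp add: bij_betw_def endo_inj_surj)
  moreover have "?\<rho> p = p" if "p \<notin> ?I" for p
    using that by (auto simp: insert_perm_def)
  ultimately show ?thesis
    unfolding sym_group_def by (auto intro: bij_imp_permutes)
qed

section \<open>Operad structure on surjective images\<close>

lemma sigma_homD:
  assumes "\<phi> \<in> sigma_hom R S T"
  shows sigma_hom_closed: "x \<in> carrier (level S n) \<Longrightarrow> \<phi> n x \<in> carrier (level T n)"
    and sigma_hom_add: "\<lbrakk>x \<in> carrier (level S n); y \<in> carrier (level S n)\<rbrakk>
      \<Longrightarrow> \<phi> n (x \<oplus>\<^bsub>level S n\<^esub> y) = \<phi> n x \<oplus>\<^bsub>level T n\<^esub> \<phi> n y"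
    and sigma_hom_smult: "\<lbrakk>r \<in> carrier R; x \<in> carrier (level S n)\<rbrakk>
      \<Longrightarrow> \<phi> n (r \<odot>\<^bsub>level S n\<^esub> x) = r \<odot>\<^bsub>level T n\<^esub> \<phi> n x"
    and sigma_hom_act: "\<lbrakk>x \<in> carrier (level S n); \<sigma> \<in> carrier (sym_group n)\<rbrakk>
      \<Longrightarrow> \<phi> n (act S n x \<sigma>) = act T n (\<phi> n x) \<sigma>"
  using assms by (auto simp: sigma_hom_def dest: PiE_mem)

lemma nonunital_operad_hom_circ:
  "\<lbrakk>\<phi> \<in> nonunital_operad_hom R P Q; 1 \<le> i; i \<le> m;
    f \<in> carrier (level P m); g \<in> carrier (level P n)\<rbrakk>
    \<Longrightarrow> \<phi> (m + n - 1) (circ P m n i f g) = circ Q m n i (\<phi> m f) (\<phi> n g)"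
  by (simp add: nonunital_operad_hom_def)

text \<open>All axioms on compositions of carrier elements are closure conditions or equations, so
  they pass to quotients: lift the arguments to \<open>Q\<close>, use the axiom there and apply
  \<open>\<phi>\<close>. Off the carriers \<open>\<phi>\<close> says nothing, hence the separate
  assumption on default values.\<close>

lemma nonunital_operad_surj_image:
  assumes "nonunital_operad R Q" and "sigma_module R P"
    and undef: "\<And>i m n f g. \<not> (1 \<le> i \<and> i \<le> m \<and> f \<in> carrier (level P m) \<and> g \<in> carrier (level P n))
        \<Longrightarrow> circ P m n i f g = undefined"
    and hom: "\<phi> \<in> nonunital_operad_hom R Q P"
    and surj: "\<And>n. carrier (level P n) \<subseteq> \<phi> n ` carrier (level Q n)"
  shows "nonunital_operad R P"
proof -
  interpret Q: nonunital_operad R Q by fact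
  interpret P: sigma_module R P by fact
  have sh: "\<phi> \<in> sigma_hom R Q P" using hom by (simp add: nonunital_operad_hom_def)
  note H = sigma_homD[OF sh]
  note circ = nonunital_operad_hom_circ[OF hom, symmetric]
  have modQ: "module R (level Q n)" for n by (rule Q.level_module)
  have lift: "\<exists>x\<in>carrier (level Q n). f = \<phi> n x" if "f \<in> carrier (level P n)" for n f
    using surj that by blast
  show ?thesis
  proof (unfold_locales, goal_cases)
    case (1 i m f g n) then show ?case by (rule undef)
  next
    case (2 i m f g n)
    then obtain x y where "x \<in> carrier (level Q m)" "f = \<phi> m x" "y \<in> carrier (level Q n)" "g = \<phi> n y"
      using lift by blast
    with 2 show ?case by (simp add: circ H Q.circ_closed del: One_nat_def)
  next
    case (3 i m f f' g n)
    then obtain x x' y where *: "x \<in> carrier (level Q m)" "f = \<phi> m x"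
      "x' \<in> carrier (level Q m)" "f' = \<phi> m x'" "y \<in> carrier (level Q n)" "g = \<phi> n y"
      using lift by meson
    interpret M: module R "level Q m" by (rule modQ)
    show ?case using 3 * by (simp add: circ H(2)[symmetric] Q.circ_closed Q.circ_add_left del: One_nat_def)
  next
    case (4 i m f g n g')
    then obtain x y y' where *: "x \<in> carrier (level Q m)" "f = \<phi> m x"
      "y \<in> carrier (level Q n)" "g = \<phi> n y" "y' \<in> carrier (level Q n)" "g' = \<phi> n y'"
      using lift by meson
    interpret M: module R "level Q n" by (rule modQ)
    show ?case using 4 * by (simp add: circ H(2)[symmetric] Q.circ_closed Q.circ_add_right del: One_nat_def)
  next
    case (5 i m r f g n)
    then obtain x y where *: "x \<in> carrier (level Q m)" "f = \<phi> m x" "y \<in> carrier (level Q n)" "g = \<phi> n y"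
      using lift by meson
    interpret M: module R "level Q m" by (rule modQ)
    show ?case using 5 * by (simp add: circ H(3)[symmetric] Q.circ_closed Q.circ_smult_left del: One_nat_def)
  next
    case (6 i m r f g n)
    then obtain x y where *: "x \<in> carrier (level Q m)" "f = \<phi> m x" "y \<in> carrier (level Q n)" "g = \<phi> n y"
      using lift by meson
    interpret M: module R "level Q n" by (rule modQ)
    show ?case using 6 * by (simp add: circ H(3)[symmetric] Q.circ_closed Q.circ_smult_right del: One_nat_def)
  next
    case (7 j a f g b h c i)
    then obtain x y z where *: "x \<in> carrier (level Q a)" "f = \<phi> a x" "y \<in> carrier (level Q b)" "g = \<phi> b y"
      "z \<in> carrier (level Q c)" "h = \<phi> c z"
      using lift by meson
    \<comment> \<open>The map \<open>\<phi>\<close> is indexed by arity, so both sides must have the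
      same one. Subtraction on naturals is truncated; here \<open>1 \<le> i < j \<le> a\<close>
      gives \<open>a \<ge> 2\<close>.\<close>
    have "a + b - 1 + c - 1 = a + c - 1 + b - 1" using 7 by simp
    moreover have "circ P (a + b - 1) c i (circ P a b j f g) h
        = \<phi> (a + b - 1 + c - 1) (circ Q (a + b - 1) c i (circ Q a b j x y) z)"
      using 7 * Q.circ_closed by (simp add: circ del: One_nat_def)
    moreover have "circ P (a + c - 1) b (j + c - 1) (circ P a c i f h) g
        = \<phi> (a + c - 1 + b - 1) (circ Q (a + c - 1) b (j + c - 1) (circ Q a c i x z) y)"
      using 7 * Q.circ_closed by (simp add: circ del: One_nat_def)
    ultimately show ?case using Q.circ_assoc_left 7 * by simp
  next
    case (8 j a f g b h c i)
    then obtain x y z where *: "x \<in> carrier (level Q a)" "f = \<phi> a x" "y \<in> carrier (level Q b)" "g = \<phi> b y"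
      "z \<in> carrier (level Q c)" "h = \<phi> c z"
      using lift by meson
    \<comment> \<open>Here \<open>j \<le> i < b + j\<close> forces \<open>b \<ge> 1\<close>, so no
      subtraction is cut off.\<close>
    have "a + b - 1 + c - 1 = a + (b + c - 1) - 1" using 8 by simp
    moreover have "circ P (a + b - 1) c i (circ P a b j f g) h
        = \<phi> (a + b - 1 + c - 1) (circ Q (a + b - 1) c i (circ Q a b j x y) z)"
      using 8 * Q.circ_closed by (simp add: circ del: One_nat_def)
    moreover have "circ P a (b + c - 1) j f (circ P b c (i - j + 1) g h)
        = \<phi> (a + (b + c - 1) - 1) (circ Q a (b + c - 1) j x (circ Q b c (i - j + 1) y z))"
      using 8 * Q.circ_closed by (simp add: circ del: One_nat_def)
    ultimately show ?case using Q.circ_assoc_middle 8 * by simp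
  next
    case (9 j a f g b h c i)
    then obtain x y z where *: "x \<in> carrier (level Q a)" "f = \<phi> a x" "y \<in> carrier (level Q b)" "g = \<phi> b y"
      "z \<in> carrier (level Q c)" "h = \<phi> c z"
      using lift by meson
    have "a + b - 1 + c - 1 = a + c - 1 + b - 1" using 9 by simp
    moreover have "circ P (a + b - 1) c i (circ P a b j f g) h
        = \<phi> (a + b - 1 + c - 1) (circ Q (a + b - 1) c i (circ Q a b j x y) z)"
      using 9 * Q.circ_closed by (simp add: circ del: One_nat_def)
    moreover have "circ P (a + c - 1) b j (circ P a c (i - b + 1) f h) g
        = \<phi> (a + c - 1 + b - 1) (circ Q (a + c - 1) b j (circ Q a c (i - b + 1) x z) y)"
      using 9 * Q.circ_closed by (simp add: circ del: One_nat_def)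
    ultimately show ?case using Q.circ_assoc_right 9 * by simp
  next
    case (10 i m f g n \<tau> \<sigma>)
    then obtain x y where *: "x \<in> carrier (level Q m)" "f = \<phi> m x" "y \<in> carrier (level Q n)" "g = \<phi> n y"
      using lift by meson
    \<comment> \<open>On the right-hand side the composition takes place at \<open>\<tau> i\<close>,
      which must be a legal input for \<open>\<phi>\<close> to commute with it.\<close>
    have \<tau>i: "1 \<le> \<tau> i" "\<tau> i \<le> m"
      using 10 permutes_in_image[of \<tau> "{1..m}" i] by (auto simp: sym_group_def)
    show ?case
      using 10 * \<tau>i insert_perm_in_sym_group[OF 10(1,2,5,6)]
      by (simp add: circ H(4)[symmetric] Q.act_closed Q.circ_closed Q.circ_equivariant del: One_nat_def)
  qed
qed

text \<open>Every element of \<open>P\<close> is an image, so each unit law for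
  \<open>\<phi> 1 e\<close> is the image of a unit law for \<open>e\<close>.\<close>

lemma operad_unit_surj_image:
  assumes hom: "\<phi> \<in> nonunital_operad_hom R Q P"
    and surj: "\<And>n. carrier (level P n) \<subseteq> \<phi> n ` carrier (level Q n)"
    and unit: "operad_unit Q e"
  shows "operad_unit P (\<phi> 1 e)"
proof -
  have e: "e \<in> carrier (level Q 1)" using unit by (simp add: operad_unit_def)
  have "\<phi> \<in> sigma_hom R Q P" using hom by (simp add: nonunital_operad_hom_def)
  then have "\<phi> 1 e \<in> carrier (level P 1)" using e by (rule sigma_homD)
  moreover have "circ P m 1 i f (\<phi> 1 e) = f" if "f \<in> carrier (level P m)" "i \<in> {1..m}" for m f i
  proof -
    obtain x where x: "x \<in> carrier (level Q m)" "f = \<phi> m x" using surj \<open>f \<in> _\<close> by blast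
    then show ?thesis
      using nonunital_operad_hom_circ[OF hom, of i m x e 1] that e unit
      by (simp add: operad_unit_def)
  qed
  moreover have "circ P 1 n 1 (\<phi> 1 e) g = g" if "g \<in> carrier (level P n)" for n g
  proof -
    obtain y where y: "y \<in> carrier (level Q n)" "g = \<phi> n y" using surj \<open>g \<in> _\<close> by blast
    then show ?thesis
      using nonunital_operad_hom_circ[OF hom, of 1 1 e y n] e unit
      by (simp add: operad_unit_def)
  qed
  ultimately show ?thesis by (simp add: operad_unit_def)
qed

text \<open>Evaluate the composite of \<open>e\<close> with \<open>e'\<close> in both ways.
  Preservation of units thus needs checking at a single unit only.\<close>

lemma operad_unit_unique:
  assumes "operad_unit P e" and "operad_unit P e'"
  shows "e = e'"
  using assms unfolding operad_unit_def by (metis atLeastAtMost_iff order_refl)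

section \<open>Underlying \<Sigma>-modules\<close>

lemma truncate_simps [simp]:
  "level (sigma_module.truncate P) = level P" "act (sigma_module.truncate P) = act P"
  by (simp_all add: sigma_module.truncate_def)

lemma sigma_module_truncate [simp]:
  "sigma_module R (sigma_module.truncate P) \<longleftrightarrow> sigma_module R P"
  by (simp add: sigma_module_def sigma_module_axioms_def)

lemma sigma_hom_truncate [simp]:
  "sigma_hom R (sigma_module.truncate P) T = sigma_hom R P T"
  "sigma_hom R S (sigma_module.truncate Q) = sigma_hom R S Q"
  by (simp_all add: sigma_hom_def)

lemma sigma_cmp_apply:
  "x \<in> carrier (level S n) \<Longrightarrow> sigma_cmp S \<psi> \<phi> n x = \<psi> n (\<phi> n x)"
  by (simp add: sigma_cmp_def compose_eq)

lemma sigma_cmp_truncate [simp]: "sigma_cmp (sigma_module.truncate P) = sigma_cmp P"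
  by (intro ext) (simp add: sigma_cmp_def)

section \<open>Algebras over the triple of a free operad functor, with or without units\<close>

text \<open>
  The last two axioms are all that depends on units: along a surjection, being an operad and
  preserving units descend from the source.
\<close>

locale operad_adjunction =
  adjunction "sigma_cat R" D F operad_forget \<eta> \<epsilon>
  for R :: "('k, 'r) ring_scheme"
    and D :: "(('k, 'a) operad, nat \<Rightarrow> 'a \<Rightarrow> 'a) category" and F \<eta> \<epsilon> +
  assumes Obj_nonunital: "P \<in> Obj D \<Longrightarrow> nonunital_operad R P"
    and Mor_nonunital: "\<phi> \<in> Mor D P Q \<Longrightarrow> \<phi> \<in> nonunital_operad_hom R P Q"
    and surj_image:
      "\<lbrakk>Q \<in> Obj D; nonunital_operad R P; \<phi> \<in> nonunital_operad_hom R Q P;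
        \<And>n. carrier (level P n) \<subseteq> \<phi> n ` carrier (level Q n)\<rbrakk> \<Longrightarrow> P \<in> Obj D \<and> \<phi> \<in> Mor D Q P"
    and surj_cancel:
      "\<lbrakk>Q \<in> Obj D; P \<in> Obj D; V \<in> Obj D; \<phi> \<in> Mor D Q P; \<psi> \<in> nonunital_operad_hom R P V;
        \<And>n. carrier (level P n) \<subseteq> \<phi> n ` carrier (level Q n); \<theta> \<in> Mor D Q V;
        \<And>n x. x \<in> carrier (level Q n) \<Longrightarrow> \<psi> n (\<phi> n x) = \<theta> n x\<rbrakk> \<Longrightarrow> \<psi> \<in> Mor D P V"
begin

lemma forget_simps [simp]:
  "omap operad_forget P = sigma_module.truncate P" "amap operad_forget P Q \<phi> = \<phi>"
  by (simp_all add: operad_forget_def)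

lemma sigma_cat_simps [simp]:
  "S \<in> Obj (sigma_cat R) \<longleftrightarrow> sigma_module R S" "Mor (sigma_cat R) = sigma_hom R"
  "Idt (sigma_cat R) = sigma_idt" "Cmp (sigma_cat R) S T V = sigma_cmp S"
  by (simp_all add: sigma_cat_def)

lemma Mor_sigma_hom: "\<phi> \<in> Mor D P Q \<Longrightarrow> \<phi> \<in> sigma_hom R P Q"
  using Mor_nonunital by (auto simp: nonunital_operad_hom_def)

lemma Obj_sigma_module: "P \<in> Obj D \<Longrightarrow> sigma_module R P"
  using Obj_nonunital by (auto simp: nonunital_operad_def)

lemma free_Obj: "sigma_module R S \<Longrightarrow> omap F S \<in> Obj D"
  using F.omap_in by simp

lemma unit_hom: "sigma_module R S \<Longrightarrow> \<eta> S \<in> sigma_hom R S (omap F S)"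
  using unit.component_in[of S] by (simp add: id_functor_def comp_functor_def)

lemma counit_Mor: "P \<in> Obj D \<Longrightarrow> \<epsilon> P \<in> Mor D (omap F (sigma_module.truncate P)) P"
  using counit.component_in[of P] by (simp add: id_functor_def comp_functor_def)

lemma free_map_Mor:
  "\<lbrakk>sigma_module R S; sigma_module R T; \<phi> \<in> sigma_hom R S T\<rbrakk>
    \<Longrightarrow> amap F S T \<phi> \<in> Mor D (omap F S) (omap F T)"
  using F.amap_in[of S T \<phi>] by simp

lemma unit_closed:
  "\<lbrakk>sigma_module R S; x \<in> carrier (level S n)\<rbrakk> \<Longrightarrow> \<eta> S n x \<in> carrier (level (omap F S) n)"
  by (rule sigma_hom_closed[OF unit_hom])

lemma unit_natural:
  assumes "sigma_module R S" "sigma_module R T" "\<phi> \<in> sigma_hom R S T" "x \<in> carrier (level S n)"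
  shows "amap F S T \<phi> n (\<eta> S n x) = \<eta> T n (\<phi> n x)"
proof -
  have "sigma_cmp S (\<eta> T) \<phi> n x = sigma_cmp S (amap F S T \<phi>) (\<eta> S) n x"
    using unit.naturality[of S T \<phi>] assms by (simp add: id_functor_def comp_functor_def)
  then show ?thesis using assms by (simp add: sigma_cmp_apply)
qed

text \<open>A triangle identity in terms of elements; it exhibits \<open>\<eta>\<close> as a section
  of the counit, which is therefore surjective.\<close>

lemma counit_unit:
  assumes "P \<in> Obj D" "x \<in> carrier (level P n)"
  shows "\<epsilon> P n (\<eta> (sigma_module.truncate P) n x) = x"
proof -
  have "sigma_cmp P (\<epsilon> P) (\<eta> (sigma_module.truncate P)) n x = sigma_idt (sigma_module.truncate P) n x"
    using triangle_U[OF assms(1)] by simp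
  then show ?thesis using assms by (simp add: sigma_cmp_apply sigma_idt_def)
qed

lemma free_Mor_eqI:
  assumes "sigma_module R S" "P \<in> Obj D" "\<phi> \<in> Mor D (omap F S) P" "\<psi> \<in> Mor D (omap F S) P"
    and "\<And>n x. x \<in> carrier (level S n) \<Longrightarrow> \<phi> n (\<eta> S n x) = \<psi> n (\<eta> S n x)"
  shows "\<phi> = \<psi>"
proof (rule hom_eq_if_unit_eq)
  \<comment> \<open>Composites are restricted to the carriers of \<open>S\<close>, so agreement
    there is equality of functions.\<close>
  have "sigma_cmp S \<phi> (\<eta> S) = sigma_cmp S \<psi> (\<eta> S)"
    using assms by (intro ext) (auto simp: sigma_cmp_def compose_def restrict_def)
  then show "Cmp (sigma_cat R) S (omap operad_forget (omap F S)) (omap operad_forget P)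
      (amap operad_forget (omap F S) P \<phi>) (\<eta> S)
    = Cmp (sigma_cat R) S (omap operad_forget (omap F S)) (omap operad_forget P)
      (amap operad_forget (omap F S) P \<psi>) (\<eta> S)" by simp
qed (use assms in auto)

text \<open>Write \<open>f\<close> and \<open>g\<close> as counit images of their generators and use
  that the counit is a homomorphism. The right-hand side involves only the underlying
  \<Sigma>-module and the structure map \<open>\<epsilon> P\<close>.\<close>

lemma counit_circ:
  assumes "P \<in> Obj D" "1 \<le> i" "i \<le> m" "f \<in> carrier (level P m)" "g \<in> carrier (level P n)"
  shows "circ P m n i f g = \<epsilon> P (m + n - 1) (circ (omap F (sigma_module.truncate P)) m n i
    (\<eta> (sigma_module.truncate P) m f) (\<eta> (sigma_module.truncate P) n g))"
proof -
  have S: "sigma_module R (sigma_module.truncate P)" using Obj_sigma_module assms(1) by simp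
  show ?thesis
    using assms unit_closed[OF S]
    by (simp add: nonunital_operad_hom_circ[OF Mor_nonunital[OF counit_Mor]] counit_unit
        del: One_nat_def)
qed

text \<open>On carriers the compositions are determined by \<open>counit_circ\<close>, elsewhere by
  the common default value.\<close>

lemma counit_inj:
  assumes P: "P \<in> Obj D" and Q: "Q \<in> Obj D"
    and eq: "sigma_module.truncate P = sigma_module.truncate Q" "\<epsilon> P = \<epsilon> Q"
  shows "P = Q"
proof -
  interpret P: nonunital_operad R P by (rule Obj_nonunital[OF P])
  interpret Q: nonunital_operad R Q by (rule Obj_nonunital[OF Q])
  have levels: "level P = level Q" "act P = act Q"
    using arg_cong[OF eq(1), of level] arg_cong[OF eq(1), of act] by simp_all
  have "circ P m n i f g = circ Q m n i f g" for m n i f g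
  proof (cases "1 \<le> i \<and> i \<le> m \<and> f \<in> carrier (level P m) \<and> g \<in> carrier (level P n)")
    case True
    then show ?thesis
      using counit_circ[OF P, of i m f g n] counit_circ[OF Q, of i m f g n] levels eq by simp
  next
    case False
    then show ?thesis using P.circ_undefined Q.circ_undefined levels by metis
  qed
  then have "circ P = circ Q" by (intro ext)
  with levels show ?thesis by (intro operad.equality) simp_all
qed

text \<open>Evaluating the algebra morphism equation at a composite of two generators of the free
  operad shows that \<open>\<phi>\<close> respects compositions. That \<open>\<phi>\<close> lies in
  \<open>D\<close> then follows by cancelling the surjective counit of \<open>P\<close>.\<close>

lemma lift_hom:
  assumes P: "P \<in> Obj D" and Q: "Q \<in> Obj D" and hom: "\<phi> \<in> sigma_hom R P Q"
    and eq: "\<And>n x. x \<in> carrier (level (omap F (sigma_module.truncate P)) n) \<Longrightarrow> \<phi> n (\<epsilon> P n x)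
      = \<epsilon> Q n (amap F (sigma_module.truncate P) (sigma_module.truncate Q) \<phi> n x)"
  shows "\<phi> \<in> Mor D P Q"
proof -
  let ?P = "sigma_module.truncate P" and ?Q = "sigma_module.truncate Q"
  let ?F\<phi> = "amap F ?P ?Q \<phi>"
  have mods: "sigma_module R ?P" "sigma_module R ?Q"
    using Obj_sigma_module P Q by simp_all
  have F\<phi>: "?F\<phi> \<in> Mor D (omap F ?P) (omap F ?Q)"
    using free_map_Mor[OF mods] hom by simp
  note FP = Obj_nonunital[OF free_Obj[OF mods(1)]]
  have comp: "\<phi> (m + n - 1) (circ P m n i f g) = circ Q m n i (\<phi> m f) (\<phi> n g)"
    if i: "1 \<le> i" "i \<le> m" and f: "f \<in> carrier (level P m)" and g: "g \<in> carrier (level P n)"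
    for m n i f g
  proof -
    let ?z = "circ (omap F ?P) m n i (\<eta> ?P m f) (\<eta> ?P n g)"
    have cl: "\<eta> ?P m f \<in> carrier (level (omap F ?P) m)" "\<eta> ?P n g \<in> carrier (level (omap F ?P) n)"
      using unit_closed[OF mods(1)] f g by simp_all
    have "?z \<in> carrier (level (omap F ?P) (m + n - 1))"
      using nonunital_operad.circ_closed[OF FP i] cl by simp
    then have "\<phi> (m + n - 1) (circ P m n i f g) = \<epsilon> Q (m + n - 1) (?F\<phi> (m + n - 1) ?z)"
      using counit_circ[OF P i f g] eq by simp
    also have "?F\<phi> (m + n - 1) ?z = circ (omap F ?Q) m n i (\<eta> ?Q m (\<phi> m f)) (\<eta> ?Q n (\<phi> n g))"
      using nonunital_operad_hom_circ[OF Mor_nonunital[OF F\<phi>] i cl] unit_natural[OF mods, of \<phi>] hom f g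
      by simp
    also have "\<epsilon> Q (m + n - 1) \<dots> = circ Q m n i (\<phi> m f) (\<phi> n g)"
      using counit_circ[OF Q i] sigma_hom_closed[OF hom] f g by simp
    finally show ?thesis .
  qed
  have nonunital: "\<phi> \<in> nonunital_operad_hom R P Q"
    using hom comp by (simp add: nonunital_operad_hom_def)
  have "Cmp D (omap F ?P) (omap F ?Q) Q (\<epsilon> Q) ?F\<phi> \<in> Mor D (omap F ?P) Q"
    using F.D.Cmp_in[OF free_Obj[OF mods(1)] free_Obj[OF mods(2)] Q F\<phi> counit_Mor[OF Q]] .
  \<comment> \<open>Composition in \<open>D\<close> is abstract; functoriality of the forgetful
    functor identifies it with composition of maps.\<close>
  then have comp_Mor: "sigma_cmp (omap F ?P) (\<epsilon> Q) ?F\<phi> \<in> Mor D (omap F ?P) Q"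
    using U.amap_Cmp[OF free_Obj[OF mods(1)] free_Obj[OF mods(2)] Q F\<phi> counit_Mor[OF Q]] by simp
  have "carrier (level P n) \<subseteq> \<epsilon> P n ` carrier (level (omap F ?P) n)" for n
    using counit_unit[OF P] unit_closed[OF mods(1)] by (force intro: image_eqI[OF sym])
  then show ?thesis
    using surj_cancel[OF free_Obj[OF mods(1)] P Q counit_Mor[OF P] nonunital _ comp_Mor] eq
    by (simp add: sigma_cmp_apply)
qed

text \<open>The formula is forced by \<open>counit_circ\<close> with \<open>\<alpha>\<close> in
  place of the counit; the default value is the one that \<open>circ_undefined\<close>
  demands.\<close>

definition algebra_operad :: "('k, 'a) sigma_module \<Rightarrow> (nat \<Rightarrow> 'a \<Rightarrow> 'a) \<Rightarrow> ('k, 'a) operad"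
  where "algebra_operad S \<alpha> = \<lparr>level = level S, act = act S,
    circ = (\<lambda>m n i f g.
      if 1 \<le> i \<and> i \<le> m \<and> f \<in> carrier (level S m) \<and> g \<in> carrier (level S n)
      then \<alpha> (m + n - 1) (circ (omap F S) m n i (\<eta> S m f) (\<eta> S n g))
      else undefined)\<rparr>"

lemma truncate_algebra_operad [simp]: "sigma_module.truncate (algebra_operad S \<alpha>) = S"
  by (simp add: algebra_operad_def sigma_module.truncate_def)

text \<open>The structure map is a surjective homomorphism from the free operad onto
  \<open>algebra_operad S \<alpha>\<close>, so the latter inherits the axioms.\<close>

lemma lift_algebra:
  assumes "triple_algebra (sigma_cat R) (induced_triple F operad_forget \<eta> \<epsilon>) S \<alpha>"
  shows "\<exists>P\<in>Obj D. sigma_module.truncate P = S \<and> \<epsilon> P = \<alpha>"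
proof -
  let ?FS = "omap F S" and ?TS = "sigma_module.truncate (omap F S)"
  let ?P = "algebra_operad S \<alpha>"
  have S: "sigma_module R S" and \<alpha>: "\<alpha> \<in> sigma_hom R ?FS S"
    and mult: "sigma_cmp (omap F ?TS) \<alpha> (amap F ?TS S \<alpha>) = sigma_cmp (omap F ?TS) \<alpha> (\<epsilon> ?FS)"
    and unit_law: "sigma_cmp S \<alpha> (\<eta> S) = sigma_idt S"
    using assms by (simp_all add: triple_algebra_def induced_triple_def comp_functor_def Let_def)
  note FS = free_Obj[OF S]
  have TS: "sigma_module R ?TS" using Obj_sigma_module[OF FS] by simp
  note FTS = free_Obj[OF TS]
  have \<alpha>\<eta>: "\<alpha> n (\<eta> S n x) = x" if "x \<in> carrier (level S n)" for n x
    using fun_cong[OF fun_cong[OF unit_law, of n], of x] that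
    by (simp add: sigma_cmp_apply sigma_idt_def)
  have \<alpha>\<mu>: "\<alpha> n (amap F ?TS S \<alpha> n z) = \<alpha> n (\<epsilon> ?FS n z)" if "z \<in> carrier (level (omap F ?TS) n)" for n z
    using fun_cong[OF fun_cong[OF mult, of n], of z] that by (simp add: sigma_cmp_apply)
  have F\<alpha>: "amap F ?TS S \<alpha> \<in> Mor D (omap F ?TS) ?FS"
    using free_map_Mor[OF TS S] \<alpha> by simp
  have P_simps: "level ?P = level S" "act ?P = act S" by (simp_all add: algebra_operad_def)
  have P_mod: "sigma_module R ?P"
    using S by (simp add: sigma_module_def sigma_module_axioms_def P_simps)
  have P_hom: "\<alpha> \<in> sigma_hom R ?FS ?P"
    using \<alpha> by (simp add: sigma_hom_def P_simps)
  \<comment> \<open>Evaluate both sides of the associativity law of \<open>\<alpha>\<close> at \<open>\<eta> x \<circ>\<^sub>i \<eta> y\<close> in the free operad on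
    \<open>T S\<close>: \<open>T \<alpha>\<close> and the counit are operad morphisms.\<close>
  have "\<alpha> (m + n - 1) (circ ?FS m n i x y) = circ ?P m n i (\<alpha> m x) (\<alpha> n y)"
    if i: "1 \<le> i" "i \<le> m" and x: "x \<in> carrier (level ?FS m)" and y: "y \<in> carrier (level ?FS n)"
    for m n i x y
  proof -
    let ?z = "circ (omap F ?TS) m n i (\<eta> ?TS m x) (\<eta> ?TS n y)"
    have cl: "\<eta> ?TS m x \<in> carrier (level (omap F ?TS) m)" "\<eta> ?TS n y \<in> carrier (level (omap F ?TS) n)"
      using unit_closed[OF TS] x y by simp_all
    have z: "?z \<in> carrier (level (omap F ?TS) (m + n - 1))"
      using nonunital_operad.circ_closed[OF Obj_nonunital[OF FTS] i cl] .
    have "circ ?FS m n i x y = \<epsilon> ?FS (m + n - 1) ?z"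
      by (rule counit_circ[OF FS i x y])
    then have "\<alpha> (m + n - 1) (circ ?FS m n i x y) = \<alpha> (m + n - 1) (amap F ?TS S \<alpha> (m + n - 1) ?z)"
      using \<alpha>\<mu>[OF z] by simp
    also have "amap F ?TS S \<alpha> (m + n - 1) ?z = circ ?FS m n i (\<eta> S m (\<alpha> m x)) (\<eta> S n (\<alpha> n y))"
      using nonunital_operad_hom_circ[OF Mor_nonunital[OF F\<alpha>] i cl] unit_natural[OF TS S, of \<alpha>] \<alpha> x y
      by simp
    finally show ?thesis
      using i sigma_hom_closed[OF \<alpha>] x y by (simp add: algebra_operad_def)
  qed
  then have hom: "\<alpha> \<in> nonunital_operad_hom R ?FS ?P"
    using P_hom by (simp add: nonunital_operad_hom_def)
  have surj: "carrier (level ?P n) \<subseteq> \<alpha> n ` carrier (level ?FS n)" for n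
    using \<alpha>\<eta> unit_closed[OF S] by (force simp: P_simps intro: image_eqI[OF sym])
  have "nonunital_operad R ?P"
    by (rule nonunital_operad_surj_image[OF Obj_nonunital[OF FS] P_mod _ hom surj])
      (auto simp: algebra_operad_def)
  then have P: "?P \<in> Obj D" "\<alpha> \<in> Mor D ?FS ?P"
    using surj_image[OF FS _ hom surj] by simp_all
  \<comment> \<open>Both are morphisms out of the free operad on \<open>S\<close> that restrict to
    the identity along \<open>\<eta> S\<close>.\<close>
  have "\<epsilon> ?P = \<alpha>"
    using free_Mor_eqI[OF S P(1) _ P(2), of "\<epsilon> ?P"] counit_Mor[OF P(1)] counit_unit[OF P(1)] \<alpha>\<eta>
    by (simp add: P_simps)
  with P(1) show ?thesis by (intro bexI[of _ ?P]) simp_all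
qed

lemma algebra_iff_operad:
  "(\<exists>\<alpha>. triple_algebra (sigma_cat R) (induced_triple F operad_forget \<eta> \<epsilon>) S \<alpha>)
    \<longleftrightarrow> (\<exists>P\<in>Obj D. omap operad_forget P = S)"
  using lift_algebra counit_triple_algebra by fastforce

lemma algebra_cat_isomorphism:
  "\<exists>K. category_isomorphism (algebra_cat (sigma_cat R) (induced_triple F operad_forget \<eta> \<epsilon>)) D K \<and>
    functor_eq (algebra_cat (sigma_cat R) (induced_triple F operad_forget \<eta> \<epsilon>))
      (comp_functor operad_forget K) algebra_forget"
proof (rule category_isomorphism_algebra_cat[OF adjunction_axioms], goal_cases)
  case 1 then show ?case by simp
next
  case 2 then show ?case using lift_algebra by simp
next
  case 3 then show ?case using counit_inj by simp
next
  case (4 P Q \<phi>)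
  let ?FP = "omap F (sigma_module.truncate P)"
  have eq: "sigma_cmp ?FP \<phi> (\<epsilon> P)
      = sigma_cmp ?FP (\<epsilon> Q) (amap F (sigma_module.truncate P) (sigma_module.truncate Q) \<phi>)"
    using 4 by simp
  have "\<phi> n (\<epsilon> P n x) = \<epsilon> Q n (amap F (sigma_module.truncate P) (sigma_module.truncate Q) \<phi> n x)"
    if "x \<in> carrier (level ?FP n)" for n x
    using fun_cong[OF fun_cong[OF eq, of n], of x] that by (simp add: sigma_cmp_apply)
  then show ?case using lift_hom 4 by simp
qed

end

section \<open>The non-unital and the unital case\<close>

text \<open>Objects and arrows of \<open>D\<close> are here all non-unital operads and all their
  homomorphisms, so the conclusions about surjections are among their hypotheses.\<close>

lemma operad_adjunction_nonunital:
  assumes "adjunction (sigma_cat R) (nonunital_operad_cat R) F operad_forget \<eta> \<epsilon>"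
  shows "operad_adjunction R (nonunital_operad_cat R) F \<eta> \<epsilon>"
  using assms by (simp add: operad_adjunction_def operad_adjunction_axioms_def nonunital_operad_cat_def)

text \<open>A surjective homomorphism carries a unit to a unit, so its target is an operad. For
  cancellation, uniqueness makes \<open>\<phi> 1 e\<close> the only unit of \<open>P\<close>, and
  \<open>\<psi>\<close> sends it to \<open>\<theta> 1 e\<close>, a unit of \<open>V\<close>.\<close>

lemma operad_adjunction_unital:
  assumes "adjunction (sigma_cat R) (operad_cat R) F operad_forget \<eta> \<epsilon>"
  shows "operad_adjunction R (operad_cat R) F \<eta> \<epsilon>"
proof (intro operad_adjunction.intro operad_adjunction_axioms.intro assms, goal_cases)
  case (1 P)
  then show ?case by (simp add: operad_cat_def operad_def)
next
  case (2 \<phi> P Q)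
  then show ?case by (simp add: operad_cat_def operad_hom_def)
next
  case (3 Q P \<phi>)
  then show ?case
    using operad_unit_surj_image[OF 3(3,4)]
    by (auto simp: operad_cat_def operad_hom_def operad_def operad_axioms_def)
next
  case (4 Q P V \<phi> \<psi> \<theta>)
  obtain e where e: "operad_unit Q e"
    using 4(1) by (auto simp: operad_cat_def operad_def operad_axioms_def)
  have "operad_unit P (\<phi> 1 e)" "operad_unit V (\<theta> 1 e)"
    using 4(4,7) e by (simp_all add: operad_cat_def operad_hom_def)
  moreover have "\<psi> 1 (\<phi> 1 e) = \<theta> 1 e"
    using 4(8) e by (simp add: operad_unit_def)
  ultimately show ?case
    using 4(5) operad_unit_unique by (fastforce simp: operad_cat_def operad_hom_def)
qed

theorem theorem40:
  fixes R :: "('k, 'r) ring_scheme"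
    and \<Psi> \<Gamma> :: "(('k, 'a) sigma_module, nat \<Rightarrow> 'a \<Rightarrow> 'a, ('k, 'a) operad, nat \<Rightarrow> 'a \<Rightarrow> 'a) cfunctor"
  assumes "cring R"
    and "adjunction (sigma_cat R) (nonunital_operad_cat R) \<Psi> operad_forget \<eta>\<^sub>\<Psi> \<epsilon>\<^sub>\<Psi>"
    and "adjunction (sigma_cat R) (operad_cat R) \<Gamma> operad_forget \<eta>\<^sub>\<Gamma> \<epsilon>\<^sub>\<Gamma>"
    and "T\<^sub>\<Psi> = induced_triple \<Psi> operad_forget \<eta>\<^sub>\<Psi> \<epsilon>\<^sub>\<Psi>"
    and "T\<^sub>\<Gamma> = induced_triple \<Gamma> operad_forget \<eta>\<^sub>\<Gamma> \<epsilon>\<^sub>\<Gamma>"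
  shows
    "(\<forall>S. sigma_module R S \<longrightarrow>
        ((\<exists>\<alpha>. triple_algebra (sigma_cat R) T\<^sub>\<Psi> S \<alpha>)
          \<longleftrightarrow> (\<exists>P. nonunital_operad R P \<and> omap operad_forget P = S))) \<and>
     (\<forall>S. sigma_module R S \<longrightarrow>
        ((\<exists>\<alpha>. triple_algebra (sigma_cat R) T\<^sub>\<Gamma> S \<alpha>)
          \<longleftrightarrow> (\<exists>P. operad R P \<and> omap operad_forget P = S))) \<and>
     (\<exists>K. category_isomorphism (algebra_cat (sigma_cat R) T\<^sub>\<Psi>) (nonunital_operad_cat R) K \<and>
        functor_eq (algebra_cat (sigma_cat R) T\<^sub>\<Psi>) (comp_functor operad_forget K) algebra_forget) \<and>
     (\<exists>K. category_isomorphism (algebra_cat (sigma_cat R) T\<^sub>\<Gamma>) (operad_cat R) K \<and>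
        functor_eq (algebra_cat (sigma_cat R) T\<^sub>\<Gamma>) (comp_functor operad_forget K) algebra_forget)"
proof -
  interpret Psi: operad_adjunction R "nonunital_operad_cat R" \<Psi> \<eta>\<^sub>\<Psi> \<epsilon>\<^sub>\<Psi>
    using assms(2) by (rule operad_adjunction_nonunital)
  interpret Gamma: operad_adjunction R "operad_cat R" \<Gamma> \<eta>\<^sub>\<Gamma> \<epsilon>\<^sub>\<Gamma>
    using assms(3) by (rule operad_adjunction_unital)
  have "P \<in> Obj (nonunital_operad_cat R) \<longleftrightarrow> nonunital_operad R P"
    and "P \<in> Obj (operad_cat R) \<longleftrightarrow> operad R P" for P :: "('k, 'a) operad"
    by (simp_all add: nonunital_operad_cat_def operad_cat_def)
  then show ?thesis
    unfolding assms(4,5)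
    using Psi.algebra_iff_operad Gamma.algebra_iff_operad
      Psi.algebra_cat_isomorphism Gamma.algebra_cat_isomorphism
    by (auto simp: Bex_def)
qed

end
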